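(* Let $F=[0,1]$ with the Euclidean metric. Then $\sigma(F)=[1,2]$, and for every $\delta\in\sigma(F)$ there is a choice $P$ of abstract rationals in $F$ with $d(P)=\delta$ such that (with $F_t$ defined using $P$) $$\dim_{\mathrm H}F_t=\frac{d(P)}{t}\qquad\text{for all }t\geq d(P).$$
   Context: For a non-empty totally bounded metric space $F$ with metric $\rho$, a set $A\subseteq F$ is $r$-separated if $\rho(a,b)\geq r$ for all distinct $a,b\in A$. A choice of abstract rationals in $F$ is a family $P=(P(q))_{q\in\mathbb{N}}$, $\mathbb N=\{1,2,\dots\}$, where each $P(q)\subseteq F$ is a maximal $(1/q)$-separated set, i.e. it is $(1/q)$-separated and no further point of $F$ can be added while keeping it $(1/q)$-separated. Given such a choice and $t>0$, $$F_t=\bigcap_{N}\bigcup_{q>N}\bigcup_{p\in P(q)}B(p,1/q^t),$$ where $B(x,r)$ denotes the closed ball in $F$; that is, $F_t$ is the set of $x\in F$ such that for infinitely many $q$ there is $p\in P(q)$ with $\rho(p,x)\leq 1/q^t$. $\mathcal{H}^s$ denotes $s$-dimensional Hausdorff measure and $\dim_{\mathrm H}$ Hausdorff dimension. A compact metric space $F$ is $s$-Ahlfors--David regular if there is $C>0$ with $r^s/C\leq\mathcal{H}^s(B(x,r))\leq Cr^s$ for all $0<r<1$ and $x\in F$; $[0,1]$ is such a space with $s=1$. For an $s$-Ahlfors--David regular $F$ and a choice $P$ of abstract rationals in $F$, the Dirichlet exponent is $$d(P)=\sup\{\delta>0 : \text{there is a ball } B\subset F \text{ of positive radius with } \mathcal{H}^s(B\setminus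 F_\delta)=0\},$$ and the Dirichlet spectrum of $F$ is $\sigma(F)=\{d(P): P\text{ is a choice of abstract rationals in }F\}$. *)

theory Defs
  imports "HOL-Analysis.Analysis"
begin

section \<open>Hausdorff measure and dimension\<close>

text \<open>
  The gauge is \<open>diam U ^ s\<close>, with the usual conventions for the empty set and for \<open>s = 0\<close>
  (a nonempty set counts 1, so that \<open>\<H>\<^sup>0\<close> is the counting measure); \<^const>\<open>powr\<close> would
  give 0 for a singleton. It is only used for bounded sets, because \<^const>\<open>diameter\<close> is
  meaningless for unbounded ones. There is no normalising constant, so on the line the
  measure for \<open>s = 1\<close> is Lebesgue outer measure.
\<close>

definition hausdorff_gauge :: "real \<Rightarrow> 'a::metric_space set \<Rightarrow> ennreal" where
  "hausdorff_gauge s U =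
     (if U = {} then 0 else if s = 0 then 1 else ennreal (diameter U powr s))"

definition hausdorff_premeasure :: "real \<Rightarrow> real \<Rightarrow> 'a::metric_space set \<Rightarrow> ennreal" where
  "hausdorff_premeasure s \<epsilon> A =
     Inf {(\<Sum>i. hausdorff_gauge s (U i)) | U :: nat \<Rightarrow> 'a set.
            A \<subseteq> (\<Union>i. U i) \<and> (\<forall>i. bounded (U i) \<and> diameter (U i) \<le> \<epsilon>)}"

definition hausdorff_measure :: "real \<Rightarrow> 'a::metric_space set \<Rightarrow> ennreal" where
  "hausdorff_measure s A = (SUP \<epsilon>\<in>{0<..}. hausdorff_premeasure s \<epsilon> A)"

definition hausdorff_dim :: "'a::metric_space set \<Rightarrow> ereal" where
  "hausdorff_dim A = Inf (ereal ` {s. 0 \<le> s \<and> hausdorff_measure s A = 0})"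

section \<open>Abstract rationals\<close>

definition separated :: "real \<Rightarrow> 'a::metric_space set \<Rightarrow> bool" where
  "separated r A \<longleftrightarrow> (\<forall>a\<in>A. \<forall>b\<in>A. a \<noteq> b \<longrightarrow> r \<le> dist a b)"

definition maximal_separated :: "'a::metric_space set \<Rightarrow> real \<Rightarrow> 'a set \<Rightarrow> bool" where
  "maximal_separated F r A \<longleftrightarrow>
     A \<subseteq> F \<and> separated r A \<and> (\<forall>x\<in>F - A. \<not> separated r (insert x A))"

text \<open>
  The index \<open>q\<close> runs over the positive integers. The value \<open>P 0\<close> is unconstrained and
  never used below: in the limsup set, \<open>q > N\<close> forces \<open>q \<ge> 1\<close>.
\<close>

definition abstract_rationals :: "'a::metric_space set \<Rightarrow> (nat \<Rightarrow> 'a set) \<Rightarrow> bool" where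
  "abstract_rationals F P \<longleftrightarrow> (\<forall>q\<ge>1. maximal_separated F (1 / real q) (P q))"

definition well_approximable :: "'a::metric_space set \<Rightarrow> (nat \<Rightarrow> 'a set) \<Rightarrow> real \<Rightarrow> 'a set" where
  "well_approximable F P t =
     (\<Inter>N. \<Union>q\<in>{N<..}. \<Union>p\<in>P q. cball p (1 / real q powr t) \<inter> F)"

section \<open>Dirichlet exponent and spectrum\<close>

text \<open>
  The parameter \<open>s\<close> is the exponent for which \<open>F\<close> is Ahlfors--David regular. The exponent
  is an extended real because the supremum is not bounded a priori. Balls of \<open>F\<close> are
  traces \<open>cball x r \<inter> F\<close> centred at points of \<open>F\<close>.
\<close>

definition dirichlet_exponent ::
    "real \<Rightarrow> 'a::metric_space set \<Rightarrow> (nat \<Rightarrow> 'a set) \<Rightarrow> ereal" where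
  "dirichlet_exponent s F P =
     Sup (ereal ` {\<delta>. 0 < \<delta> \<and>
       (\<exists>x\<in>F. \<exists>r>0. hausdorff_measure s ((cball x r \<inter> F) - well_approximable F P \<delta>) = 0)})"

definition dirichlet_spectrum :: "real \<Rightarrow> 'a::metric_space set \<Rightarrow> ereal set" where
  "dirichlet_spectrum s F = {dirichlet_exponent s F P | P. abstract_rationals F P}"

end

theory Submission
  imports Defs
begin

text \<open>
  A maximal \<open>1/q\<close>-separated set is \<open>1/q\<close>-dense, so \<open>F\<^sub>1 = F\<close>; it has at most \<open>q + 1\<close> points, so
  \<open>F\<^sub>t\<close> is null for \<open>t > 2\<close> by Borel--Cantelli. Hence \<open>1 \<le> d(P) \<le> 2\<close>. For \<open>1 \<le> \<delta> \<le> 2\<close> choose \<open>P\<close>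
  such that, as \<open>q\<close> runs through \<open>{2 ^ k..<2 ^ (k + 1)}\<close>, the sets \<open>P(q)\<close> together make up the
  dyadic grid of mesh \<open>2 ^ -\<lfloor>k * \<delta>\<rfloor>\<close>. Then \<open>F\<^sub>t\<close> is essentially the set of points that for infinitely
  many \<open>k\<close> are \<open>2 ^ (-k * t)\<close>-close to that grid. It is everything for \<open>t < \<delta>\<close>, and counting grid
  points gives \<open>dim F\<^sub>t \<le> \<delta> / t\<close>. For the lower bound with \<open>s < \<delta> / t\<close>, write the binary
  digits of \<open>u \<in> [0, 1)\<close> into the positions outside very sparse blocks
  \<open>[\<lfloor>k * \<delta>\<rfloor>, \<lceil>(k + 1) * t\<rceil>)\<close> and fill the blocks with zeros: the resulting point lies in \<open>F\<^sub>t\<close>, and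
  it determines \<open>u\<close> in an \<open>s\<close>-Hoelder way, so \<open>\<H>\<^sup>s(F\<^sub>t) > 0\<close>.
\<close>

section \<open>Hausdorff measure\<close>

lemma hausdorff_measure_zeroI:
  assumes "\<And>\<epsilon> e. 0 < \<epsilon> \<Longrightarrow> 0 < e \<Longrightarrow> \<exists>U::nat \<Rightarrow> 'a::metric_space set.
      A \<subseteq> (\<Union>i. U i) \<and> (\<forall>i. bounded (U i) \<and> diameter (U i) \<le> \<epsilon>) \<and>
      (\<Sum>i. hausdorff_gauge s (U i)) \<le> ennreal e"
  shows "hausdorff_measure s A = 0"
proof -
  have "hausdorff_premeasure s \<epsilon> A \<le> 0" if "0 < \<epsilon>" for \<epsilon>
  proof (rule ennreal_le_epsilon)
    fix e :: real
    assume "0 < e"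
    from assms[OF that this] obtain U :: "nat \<Rightarrow> 'a set" where U: "A \<subseteq> (\<Union>i. U i)"
        "\<forall>i. bounded (U i) \<and> diameter (U i) \<le> \<epsilon>" "(\<Sum>i. hausdorff_gauge s (U i)) \<le> ennreal e"
      by blast
    have "hausdorff_premeasure s \<epsilon> A \<le> (\<Sum>i. hausdorff_gauge s (U i))"
      unfolding hausdorff_premeasure_def using U(1,2) by (intro Inf_lower) blast
    with U(3) show "hausdorff_premeasure s \<epsilon> A \<le> 0 + ennreal e"
      by simp
  qed
  then show ?thesis
    by (simp add: hausdorff_measure_def)
qed

lemma hausdorff_measure_zeroE:
  assumes "hausdorff_measure s A = 0" "0 < \<epsilon>" "0 < e"
  obtains U :: "nat \<Rightarrow> 'a::metric_space set" where "A \<subseteq> (\<Union>i. U i)" "\<And>i. bounded (U i)"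
    "\<And>i. diameter (U i) \<le> \<epsilon>" "(\<Sum>i. hausdorff_gauge s (U i)) < ennreal e"
proof -
  have "hausdorff_premeasure s \<epsilon> A \<le> hausdorff_measure s A"
    unfolding hausdorff_measure_def using assms(2) by (intro SUP_upper) simp
  also have "\<dots> < ennreal e"
    using assms by simp
  finally show thesis
    unfolding hausdorff_premeasure_def Inf_less_iff using that by blast
qed

lemma hausdorff_gauge_empty [simp]: "hausdorff_gauge s {} = 0"
  by (simp add: hausdorff_gauge_def)

lemma hausdorff_measure_empty [simp]: "hausdorff_measure s {} = 0"
  by (rule hausdorff_measure_zeroI, rule exI[of _ "\<lambda>_. {}"]) auto

text \<open>For \<open>s = 0\<close> each nonempty member of a cover costs 1. The Hoelder argument
  is confined to \<open>0 < s\<close>, so this excludes \<open>s = 0\<close> in the lower bound for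
  the dimension.\<close>

lemma hausdorff_measure_0_nonempty:
  assumes "A \<noteq> {}"
  shows "hausdorff_measure 0 A \<noteq> 0"
proof
  assume "hausdorff_measure 0 A = 0"
  then obtain U where U: "A \<subseteq> (\<Union>i. U i)" "(\<Sum>i. hausdorff_gauge 0 (U i)) < ennreal 1"
    by (rule hausdorff_measure_zeroE[of 0 A 1 1]) auto
  then obtain i where "U i \<noteq> {}"
    using assms by blast
  then have "1 \<le> hausdorff_gauge 0 (U i)"
    by (simp add: hausdorff_gauge_def)
  also have "\<dots> = sum (\<lambda>i. hausdorff_gauge 0 (U i)) {i}"
    by simp
  also have "\<dots> \<le> (\<Sum>i. hausdorff_gauge 0 (U i))"
    by (intro sum_le_suminf) auto
  finally show False
    using U(2) by (simp add: not_less)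
qed

lemma hausdorff_gauge_cball:
  fixes x :: "'a::euclidean_space"
  assumes "0 < s" "0 \<le> r"
  shows "hausdorff_gauge s (cball x r) = ennreal ((2 * r) powr s)"
  using assms by (simp add: hausdorff_gauge_def)

text \<open>Enumerating the centres of level \<open>k\<close> as \<open>g k j\<close> with
  \<open>j < n k\<close> makes the covering family countable by construction.\<close>

lemma hausdorff_cantelli:
  fixes g :: "nat \<Rightarrow> nat \<Rightarrow> 'a::euclidean_space"
  assumes "0 < s" "\<And>k. 0 \<le> r k" "r \<longlonglongrightarrow> 0"
    and sm: "summable (\<lambda>k. real (n k) * (2 * r k) powr s)"
    and A: "\<And>K. A \<subseteq> (\<Union>k\<in>{K<..}. \<Union>j\<in>{..<n k}. cball (g k j) (r k))"
  shows "hausdorff_measure s A = 0"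
proof (rule hausdorff_measure_zeroI)
  fix \<epsilon> e :: real
  assume "0 < \<epsilon>" "0 < e"
  define a where "a k = real (n k) * (2 * r k) powr s" for k
  have a_nonneg: "0 \<le> a k" for k
    by (simp add: a_def)
  from assms(3) \<open>0 < \<epsilon>\<close> have "eventually (\<lambda>k. r k < \<epsilon> / 2) sequentially"
    by (intro order_tendstoD(2)[where y = 0]) auto
  then obtain K1 where K1: "\<And>k. k \<ge> K1 \<Longrightarrow> r k < \<epsilon> / 2"
    by (auto simp: eventually_sequentially)
  obtain K2 where K2: "\<And>m. m \<ge> K2 \<Longrightarrow> norm (\<Sum>i. a (i + m)) < e"
    using suminf_exist_split[OF \<open>0 < e\<close> sm] unfolding a_def by blast
  \<comment> \<open>\<open>K1\<close> keeps the diameters below \<open>\<epsilon>\<close>,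
    \<open>K2\<close> keeps the tail of the series below \<open>e\<close>.\<close>
  define K where "K = max K1 K2"
  \<comment> \<open>Indices outside the range of a level are padded by the empty set, which costs
    nothing, so that all pairs \<open>(k, j)\<close> can be enumerated by
    \<open>prod_decode\<close>.\<close>
  define f where "f = (\<lambda>(k, j). if j < n (k + K) then cball (g (k + K) j) (r (k + K)) else {})"
  define U where "U i = f (prod_decode i)" for i
  have sm': "summable (\<lambda>k. a (k + K))"
    using sm by (simp add: a_def summable_iff_shift[of a, unfolded a_def])
  have "(\<Sum>j. hausdorff_gauge s (f (k, j))) = ennreal (a (k + K))" for k
  proof -
    have "(\<Sum>j. hausdorff_gauge s (f (k, j))) = (\<Sum>j<n (k + K). hausdorff_gauge s (f (k, j)))"
      by (intro suminf_finite) (auto simp: f_def)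
    also have "\<dots> = (\<Sum>j<n (k + K). ennreal ((2 * r (k + K)) powr s))"
      using assms(1,2) by (intro sum.cong) (auto simp: f_def hausdorff_gauge_cball)
    also have "\<dots> = ennreal (a (k + K))"
      by (simp add: a_def ennreal_mult ennreal_of_nat_eq_real_of_nat)
    finally show ?thesis .
  qed
  then have "(\<Sum>i. hausdorff_gauge s (U i)) = (\<Sum>k. ennreal (a (k + K)))"
    unfolding U_def by (intro suminf_ennreal_2dimen[of _ "\<lambda>p. hausdorff_gauge s (f p)"]) simp
  also have "\<dots> = ennreal (\<Sum>k. a (k + K))"
    using a_nonneg sm' by (intro suminf_ennreal2) auto
  also have "\<dots> \<le> ennreal e"
    using K2[of K] by (intro ennreal_leI) (simp add: K_def)
  finally have "(\<Sum>i. hausdorff_gauge s (U i)) \<le> ennreal e" .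
  moreover have "A \<subseteq> (\<Union>i. U i)"
  proof
    fix x
    assume "x \<in> A"
    with A[of K] obtain k j where kj: "k > K" "j < n k" "x \<in> cball (g k j) (r k)"
      by blast
    then have "x \<in> f (k - K, j)"
      by (simp add: f_def)
    then have "x \<in> U (prod_encode (k - K, j))"
      by (simp add: U_def)
    then show "x \<in> (\<Union>i. U i)"
      by blast
  qed
  moreover have "bounded (U i) \<and> diameter (U i) \<le> \<epsilon>" for i
  proof -
    obtain k j where kj: "prod_decode i = (k, j)"
      by fastforce
    have "r (k + K) < \<epsilon> / 2"
      by (rule K1) (simp add: K_def)
    then have "2 * r (k + K) \<le> \<epsilon>"
      by simp
    then show ?thesis
      using \<open>0 < \<epsilon>\<close> by (auto simp: U_def f_def kj)
  qed
  ultimately show "\<exists>U. A \<subseteq> (\<Union>i. U i) \<and> (\<forall>i. bounded (U i) \<and> diameter (U i) \<le> \<epsilon>) \<and>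
      (\<Sum>i. hausdorff_gauge s (U i)) \<le> ennreal e"
    by blast
qed

text \<open>Replaces a parameter set, of which only a bound on distances is known, by an interval of
  that length. The left end is \<open>Inf V\<close>.\<close>

lemma real_set_subset_interval:
  fixes V :: "real set"
  assumes "\<And>u v. u \<in> V \<Longrightarrow> v \<in> V \<Longrightarrow> \<bar>u - v\<bar> \<le> l"
  shows "\<exists>a. V \<subseteq> {a..a + l}"
proof (cases "V = {}")
  case False
  then obtain w where "w \<in> V"
    by blast
  with assms have bdd: "bdd_below V"
    by (intro bdd_belowI[of _ "w - l"]) (fastforce simp: abs_le_iff)
  have "v \<le> Inf V + l" if "v \<in> V" for v
  proof -
    have "v - l \<le> Inf V"
      using False assms[OF that] by (intro cInf_greatest) (auto simp: abs_le_iff algebra_simps)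
    then show ?thesis
      by simp
  qed
  with bdd show ?thesis
    by (intro exI[of _ "Inf V"]) (auto intro: cInf_lower)
qed auto

text \<open>Replaces the mass distribution principle: a parametrisation \<open>h\<close> whose inverse is
  \<open>s\<close>-Hoelder turns a cheap cover of the image into a cover of the parameter set of small length.\<close>

lemma negligible_if_hausdorff_measure_zero:
  fixes h :: "real \<Rightarrow> 'a::metric_space"
  assumes zero: "hausdorff_measure s A = 0" and "0 < s" "0 < K" "h ` S \<subseteq> A"
    and hoelder: "\<And>u v. u \<in> S \<Longrightarrow> v \<in> S \<Longrightarrow> dist (h u) (h v) \<le> 1 \<Longrightarrow>
       \<bar>u - v\<bar> \<le> K * dist (h u) (h v) powr s"
  shows "negligible S"
  unfolding negligible_outer_le
proof (intro allI impI)
  fix e :: real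
  assume "0 < e"
  then have "0 < e / K"
    using \<open>0 < K\<close> by simp
  \<comment> \<open>Diameters at most 1 make \<open>hoelder\<close> applicable to any two parameters
    whose images share a \<open>U i\<close>. The cost \<open>e / K\<close> makes up for the factor
    \<open>K\<close> in the lengths.\<close>
  from hausdorff_measure_zeroE[OF zero zero_less_one this] obtain U where U: "A \<subseteq> (\<Union>i. U i)"
      "\<And>i. bounded (U i)" "\<And>i. diameter (U i) \<le> 1"
      "(\<Sum>i. hausdorff_gauge s (U i)) < ennreal (e / K)"
    by blast
  define l where "l i = K * diameter (U i) powr s" for i
  have l_nonneg: "0 \<le> l i" for i
    using \<open>0 < K\<close> by (simp add: l_def)
  have "\<exists>a. {u \<in> S. h u \<in> U i} \<subseteq> {a..a + l i}" for i
  proof (rule real_set_subset_interval)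
    fix u v
    assume uv: "u \<in> {u \<in> S. h u \<in> U i}" "v \<in> {u \<in> S. h u \<in> U i}"
    then have d: "dist (h u) (h v) \<le> diameter (U i)"
      by (intro diameter_bounded_bound U(2)) auto
    then have "\<bar>u - v\<bar> \<le> K * dist (h u) (h v) powr s"
      using uv U(3)[of i] by (intro hoelder) auto
    also have "\<dots> \<le> l i"
      using d \<open>0 < s\<close> \<open>0 < K\<close> by (auto simp: l_def intro!: powr_mono2)
    finally show "\<bar>u - v\<bar> \<le> l i" .
  qed
  then obtain a where a: "\<And>i. {u \<in> S. h u \<in> U i} \<subseteq> {a i..a i + l i}"
    by metis
  define J where "J i = (if U i = {} then {} else {a i..a i + l i})" for i
  define T where "T = (\<Union>i. J i)"
  have "S \<subseteq> T"
  proof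
    fix u
    assume "u \<in> S"
    with U(1) \<open>h ` S \<subseteq> A\<close> obtain i where "h u \<in> U i"
      by blast
    with a[of i] \<open>u \<in> S\<close> show "u \<in> T"
      unfolding T_def J_def by (intro UN_I[of i]) auto
  qed
  have T: "T \<in> sets lebesgue"
    unfolding T_def J_def by (intro sets.countable_UN) auto
  have "emeasure lebesgue (J i) \<le> ennreal K * hausdorff_gauge s (U i)" for i
    using l_nonneg[of i] \<open>0 < s\<close> \<open>0 < K\<close>
    by (auto simp: J_def hausdorff_gauge_def l_def ennreal_mult)
  moreover have "emeasure lebesgue T \<le> (\<Sum>i. emeasure lebesgue (J i))"
    unfolding T_def by (intro emeasure_subadditive_countably) (auto simp: J_def)
  ultimately have "emeasure lebesgue T \<le> (\<Sum>i. ennreal K * hausdorff_gauge s (U i))"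
    by (meson order_trans suminf_le summableI)
  also have "\<dots> = ennreal K * (\<Sum>i. hausdorff_gauge s (U i))"
    by (rule ennreal_suminf_cmult)
  also have "\<dots> \<le> ennreal K * ennreal (e / K)"
    using U(4) by (intro mult_left_mono) auto
  also have "\<dots> = ennreal e"
    using \<open>0 < K\<close> \<open>0 < e\<close> by (simp flip: ennreal_mult)
  finally have le: "emeasure lebesgue T \<le> ennreal e" .
  then have "T \<in> lmeasurable"
    using T by (intro fmeasurableI) (auto simp: less_top[symmetric] top_unique)
  moreover have "measure lebesgue T \<le> e"
    using le \<open>0 < e\<close> by (simp add: measure_def enn2real_leI)
  ultimately show "\<exists>T. S \<subseteq> T \<and> T \<in> lmeasurable \<and> measure lebesgue T \<le> e"
    using \<open>S \<subseteq> T\<close> by blast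
qed

lemma negligible_if_hausdorff_measure_1_zero:
  fixes A :: "real set"
  assumes "hausdorff_measure 1 A = 0"
  shows "negligible A"
  by (rule negligible_if_hausdorff_measure_zero[OF assms, of 1 "\<lambda>x. x"]) (auto simp: dist_real_def)

section \<open>Spreading binary digits\<close>

text \<open>This is also how many digits of \<open>u\<close> have been used up once the first
  \<open>n\<close> digits of the spread point are written.\<close>

definition positions_below :: "(nat \<Rightarrow> bool) \<Rightarrow> nat \<Rightarrow> nat" where
  "positions_below A n = card {j. j < n \<and> A j}"

lemma positions_below_0 [simp]: "positions_below A 0 = 0"
  by (simp add: positions_below_def)

lemma positions_below_Suc:
  "positions_below A (Suc n) = positions_below A n + (if A n then 1 else 0)"
proof -
  have "{j. j < Suc n \<and> A j} = (if A n then insert n {j. j < n \<and> A j} else {j. j < n \<and> A j})"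
    by (auto simp: less_Suc_eq)
  then show ?thesis
    by (simp add: positions_below_def)
qed

text \<open>The first \<open>n\<close> binary digits of the spread point, read as an integer. At a
  position in \<open>A\<close> the next digit of \<open>u\<close> is appended, expressed as a
  difference of floors.\<close>

primrec spread_digits :: "(nat \<Rightarrow> bool) \<Rightarrow> real \<Rightarrow> nat \<Rightarrow> int" where
  "spread_digits A u 0 = 0"
| "spread_digits A u (Suc n) = 2 * spread_digits A u n +
     (if A n then \<lfloor>2 ^ Suc (positions_below A n) * u\<rfloor> - 2 * \<lfloor>2 ^ positions_below A n * u\<rfloor> else 0)"

text \<open>The binary digits of \<open>u\<close> are written, in order, into the positions in \<open>A\<close>; all other
  binary digits are 0. Position \<open>j\<close> has weight \<open>2 ^ -(j + 1)\<close>.\<close>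

definition spread :: "(nat \<Rightarrow> bool) \<Rightarrow> real \<Rightarrow> real" where
  "spread A u = (SUP n. real_of_int (spread_digits A u n) / 2 ^ n)"

lemma next_binary_digit: "\<lfloor>2 ^ Suc n * u\<rfloor> - 2 * \<lfloor>2 ^ n * u\<rfloor> \<in> {0, 1}" for u :: real
proof -
  have "2 * \<lfloor>2 ^ n * u\<rfloor> \<le> \<lfloor>2 ^ Suc n * u\<rfloor>" "\<lfloor>2 ^ Suc n * u\<rfloor> \<le> 2 * \<lfloor>2 ^ n * u\<rfloor> + 1"
    by (simp_all only: power_Suc mult.assoc) linarith+
  then show ?thesis
    by auto
qed

lemma spread_digits_Suc_bounds:
  "2 * spread_digits A u n \<le> spread_digits A u (Suc n)"
  "spread_digits A u (Suc n) \<le> 2 * spread_digits A u n + 1"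
  using next_binary_digit[of "positions_below A n" u] by auto

lemma spread_digits_bounds: "0 \<le> spread_digits A u n" "spread_digits A u n < 2 ^ n"
proof -
  have "0 \<le> spread_digits A u n \<and> spread_digits A u n < 2 ^ n"
  proof (induction n)
    case (Suc n)
    then show ?case
      using spread_digits_Suc_bounds[of A u n] by (simp del: spread_digits.simps)
  qed simp
  then show "0 \<le> spread_digits A u n" "spread_digits A u n < 2 ^ n"
    by auto
qed

lemma incseq_spread_digits: "incseq (\<lambda>n. real_of_int (spread_digits A u n) / 2 ^ n)"
proof (rule incseq_SucI)
  fix n
  have "real_of_int (2 * spread_digits A u n) \<le> real_of_int (spread_digits A u (Suc n))"
    unfolding of_int_le_iff by (rule spread_digits_Suc_bounds)
  then show "real_of_int (spread_digits A u n) / 2 ^ n \<le> real_of_int (spread_digits A u (Suc n)) / 2 ^ Suc n"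
    by (simp add: field_simps del: spread_digits.simps)
qed

lemma decseq_spread_digits: "decseq (\<lambda>n. (real_of_int (spread_digits A u n) + 1) / 2 ^ n)"
proof (rule decseq_SucI)
  fix n
  have "real_of_int (spread_digits A u (Suc n)) \<le> real_of_int (2 * spread_digits A u n + 1)"
    unfolding of_int_le_iff by (rule spread_digits_Suc_bounds)
  then have "(real_of_int (spread_digits A u (Suc n)) + 1) / 2 ^ Suc n
      \<le> (2 * real_of_int (spread_digits A u n) + 2) / 2 ^ Suc n"
    by (intro divide_right_mono) (auto simp del: spread_digits.simps)
  also have "\<dots> = (real_of_int (spread_digits A u n) + 1) / 2 ^ n"
    by (simp add: field_simps)
  finally show "(real_of_int (spread_digits A u (Suc n)) + 1) / 2 ^ Suc n \<le>
      (real_of_int (spread_digits A u n) + 1) / 2 ^ n" .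
qed

text \<open>The dyadic intervals given by the first \<open>n\<close> digits are nested, so the
  supremum of their left ends lies in all of them.\<close>

lemma spread_bounds:
  "real_of_int (spread_digits A u n) / 2 ^ n \<le> spread A u"
  "spread A u \<le> (real_of_int (spread_digits A u n) + 1) / 2 ^ n"
proof -
  have le: "real_of_int (spread_digits A u m) / 2 ^ m \<le> (real_of_int (spread_digits A u n) + 1) / 2 ^ n" for m n
  proof -
    have "real_of_int (spread_digits A u m) / 2 ^ m
        \<le> real_of_int (spread_digits A u (max m n)) / 2 ^ max m n"
      by (rule incseqD[OF incseq_spread_digits]) simp
    also have "\<dots> \<le> (real_of_int (spread_digits A u (max m n)) + 1) / 2 ^ max m n"
      by (simp add: divide_right_mono)
    also have "\<dots> \<le> (real_of_int (spread_digits A u n) + 1) / 2 ^ n"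
      by (rule decseqD[OF decseq_spread_digits]) simp
    finally show ?thesis .
  qed
  show "real_of_int (spread_digits A u n) / 2 ^ n \<le> spread A u"
    unfolding spread_def by (intro cSUP_upper bdd_aboveI2[OF le]) simp
  show "spread A u \<le> (real_of_int (spread_digits A u n) + 1) / 2 ^ n"
    unfolding spread_def by (intro cSUP_least le) simp
qed

lemma spread_in_unit_interval: "spread A u \<in> {0..1}"
  using spread_bounds[of A u 0] by simp

text \<open>Only zeros are appended between \<open>m\<close> and \<open>n\<close>, so truncating at
  \<open>m\<close> or at \<open>n\<close> gives the same point.\<close>

lemma spread_close_to_grid:
  assumes "m \<le> n" "\<And>j. m \<le> j \<Longrightarrow> j < n \<Longrightarrow> \<not> A j"
  shows "\<bar>spread A u - real_of_int (spread_digits A u m) / 2 ^ m\<bar> \<le> 1 / 2 ^ n"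
proof -
  have "real_of_int (spread_digits A u n) / 2 ^ n = real_of_int (spread_digits A u m) / 2 ^ m"
    using assms
  proof (induction n rule: dec_induct)
    case (step k)
    then show ?case
      by simp
  qed simp
  then show ?thesis
    using spread_bounds[of A u n] by (simp add: add_divide_distrib)
qed

section \<open>Expansion of distances by the spreading map\<close>

text \<open>At a free position both differences are doubled and receive the same digit difference.
  At a forced zero only the right one is doubled, which is harmless since the left one is
  nonnegative.\<close>

lemma spread_digits_diff:
  assumes "0 \<le> u" "u \<le> v" "v < 1"
  shows "\<lfloor>2 ^ positions_below A n * v\<rfloor> - \<lfloor>2 ^ positions_below A n * u\<rfloor>
    \<le> spread_digits A v n - spread_digits A u n"
proof (induction n)
  case 0
  then show ?case
    using assms floor_mono[of v 0] by (simp add: floor_eq_iff[of v 0, THEN iffD2] floor_eq_iff[of u 0, THEN iffD2])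
next
  case (Suc n)
  have "\<lfloor>2 ^ positions_below A n * u\<rfloor> \<le> \<lfloor>2 ^ positions_below A n * v\<rfloor>"
    using assms by (intro floor_mono mult_left_mono) auto
  with Suc show ?case
    by (simp add: positions_below_Suc)
qed

text \<open>Rounding the scaled parameters to integers costs at most 1, and so does truncating the
  spread points; hence the summand 2.\<close>

lemma spread_expanding:
  assumes "u \<in> {0..<1}" "v \<in> {0..<1}"
  shows "2 ^ positions_below A n * \<bar>u - v\<bar> \<le> 2 + 2 ^ n * \<bar>spread A u - spread A v\<bar>"
proof -
  have *: "2 ^ positions_below A n * (v - u) \<le> 2 + 2 ^ n * (spread A v - spread A u)"
    if "0 \<le> u" "u \<le> v" "v < 1" for u v
  proof -
    let ?a = "positions_below A n"
    have "2 ^ ?a * (v - u) - 1 \<le> real_of_int (\<lfloor>2 ^ ?a * v\<rfloor> - \<lfloor>2 ^ ?a * u\<rfloor>)"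
      unfolding right_diff_distrib of_int_diff by linarith
    also have "\<dots> \<le> real_of_int (spread_digits A v n - spread_digits A u n)"
      using spread_digits_diff[OF that] by (simp only: of_int_le_iff)
    also have "\<dots> \<le> 2 ^ n * (spread A v - spread A u) + 1"
      using spread_bounds(1)[of A v n] spread_bounds(2)[of A u n] by (simp add: field_simps)
    finally show ?thesis
      by simp
  qed
  have abs: "2 ^ n * x \<le> 2 ^ n * \<bar>x\<bar>" for x :: real
    by (intro mult_left_mono) auto
  show ?thesis
  proof (cases "u \<le> v")
    case True
    then have "2 ^ positions_below A n * \<bar>u - v\<bar> = 2 ^ positions_below A n * (v - u)"
      by simp
    also have "\<dots> \<le> 2 + 2 ^ n * (spread A v - spread A u)"
      using True assms by (intro *) auto
    also have "\<dots> \<le> 2 + 2 ^ n * \<bar>spread A u - spread A v\<bar>"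
      unfolding abs_minus_commute[of "spread A u"] by (intro add_left_mono abs)
    finally show ?thesis .
  next
    case False
    then have "2 ^ positions_below A n * \<bar>u - v\<bar> = 2 ^ positions_below A n * (u - v)"
      by simp
    also have "\<dots> \<le> 2 + 2 ^ n * (spread A u - spread A v)"
      using False assms by (intro *) auto
    also have "\<dots> \<le> 2 + 2 ^ n * \<bar>spread A u - spread A v\<bar>"
      by (intro add_left_mono abs)
    finally show ?thesis .
  qed
qed

text \<open>At a scale with \<open>2 ^ n * d \<le> 1\<close> the expansion estimate gives
  \<open>2 ^ positions_below A n * \<bar>u - v\<bar> \<le> 3\<close>, and \<open>dens\<close> bounds
  the power of 2 from below. For \<open>d > 0\<close> the largest such \<open>n\<close> is taken;
  rounding costs the factor \<open>2 powr s\<close>. For \<open>d = 0\<close> every \<open>n\<close>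
  is admissible and a limit gives \<open>u = v\<close>.\<close>

lemma inverse_spread_hoelder:
  assumes "0 < s" and dens: "\<And>n. s * real n - C \<le> real (positions_below A n)"
    and uv: "u \<in> {0..<1}" "v \<in> {0..<1}"
  shows "\<bar>u - v\<bar> \<le> 3 * 2 powr (C + s) * \<bar>spread A u - spread A v\<bar> powr s"
proof -
  define d where "d = \<bar>spread A u - spread A v\<bar>"
  have main: "\<bar>u - v\<bar> \<le> 3 * 2 powr C * 2 powr (- s * real n)" if "2 ^ n * d \<le> 1" for n
  proof -
    have "2 powr (s * real n - C) \<le> 2 ^ positions_below A n"
      using dens[of n] by (simp flip: powr_realpow)
    then have "2 powr (s * real n - C) * \<bar>u - v\<bar> \<le> 2 ^ positions_below A n * \<bar>u - v\<bar>"
      by (intro mult_right_mono) auto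
    also have "\<dots> \<le> 3"
      using spread_expanding[OF uv, of A n] that by (simp add: d_def)
    finally show ?thesis
      by (simp add: powr_diff powr_minus field_simps)
  qed
  have "d \<le> 1"
    using spread_in_unit_interval[of A u] spread_in_unit_interval[of A v] by (auto simp: d_def)
  show ?thesis
  proof (cases "d = 0")
    case True
    have "(\<lambda>n. 3 * 2 powr C * 2 powr (- s * real n)) \<longlonglongrightarrow> 3 * 2 powr C * 0"
    proof (intro tendsto_mult tendsto_const)
      have "2 powr (- s) < 1"
        using \<open>0 < s\<close> by (simp add: powr_less_one)
      then have "(\<lambda>n. (2 powr (- s)) ^ n) \<longlonglongrightarrow> 0"
        by (intro LIMSEQ_power_zero) simp
      then show "(\<lambda>n. 2 powr (- s * real n)) \<longlonglongrightarrow> 0"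
        by (simp add: powr_realpow[symmetric] powr_powr)
    qed
    then have "\<bar>u - v\<bar> \<le> 3 * 2 powr C * 0"
    proof (rule LIMSEQ_le_const, intro exI allI impI)
      fix n
      show "\<bar>u - v\<bar> \<le> 3 * 2 powr C * 2 powr (- s * real n)"
        by (rule main) (simp add: True)
    qed
    then show ?thesis
      using True by simp
  next
    case False
    then have "0 < d"
      by (simp add: d_def)
    define n where "n = nat \<lfloor>- log 2 d\<rfloor>"
    have "0 \<le> - log 2 d"
      using \<open>0 < d\<close> \<open>d \<le> 1\<close> by (simp add: log_le_zero_cancel_iff)
    then have n: "real n \<le> - log 2 d" "- log 2 d < real n + 1"
      unfolding n_def by linarith+
    have d: "2 powr (s * log 2 d) = d powr s"
      using \<open>0 < d\<close> by (simp add: powr_def log_def)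
    have "2 ^ n * d = 2 powr (real n + log 2 d)"
      using \<open>0 < d\<close> by (simp add: powr_add powr_realpow)
    also have "\<dots> \<le> 2 powr 0"
      using n by (intro powr_mono) auto
    finally have "\<bar>u - v\<bar> \<le> 3 * 2 powr C * 2 powr (- s * real n)"
      by (intro main) simp
    also have "\<dots> \<le> 3 * 2 powr C * 2 powr (s + s * log 2 d)"
    proof -
      have "s * (- log 2 d) \<le> s * (real n + 1)"
        using n \<open>0 < s\<close> by (intro mult_left_mono) auto
      then show ?thesis
        by (intro mult_left_mono powr_mono) (auto simp: algebra_simps)
    qed
    also have "\<dots> = 3 * 2 powr (C + s) * d powr s"
      by (simp add: powr_add d)
    finally show ?thesis
      by (simp add: d_def)
  qed
qed

section \<open>Density of the free positions\<close>

lemma positions_below_ge: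
  assumes "n \<le> m" "\<And>j. n \<le> j \<Longrightarrow> j < m \<Longrightarrow> A j"
  shows "positions_below A n + (m - n) \<le> positions_below A m"
  using assms by (induction m rule: dec_induct) (auto simp: positions_below_Suc)

lemma positions_below_mono: "n \<le> m \<Longrightarrow> positions_below A n \<le> positions_below A m"
  unfolding positions_below_def by (intro card_mono) auto

text \<open>The critical places are the starts \<open>e (Suc i)\<close> of free stretches, where by
  \<open>gain\<close> the preceding stretch alone supplies enough positions. Along a free stretch
  the count has slope \<open>1 \<ge> s\<close>; between \<open>m i\<close> and
  \<open>e (Suc i)\<close> the bound at the end already holds.\<close>

lemma positions_below_density:
  fixes e m :: "nat \<Rightarrow> nat"
  assumes "e 0 = 0" "\<And>i. e i \<le> m i" "\<And>i. m i < e (Suc i)"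
    and A: "\<And>i j. e i \<le> j \<Longrightarrow> j < m i \<Longrightarrow> A j"
    and gain: "\<And>i. s * real (e (Suc i)) - C \<le> real (m i - e i)"
    and "0 \<le> s" "s \<le> 1" "0 \<le> C"
  shows "s * real n - C \<le> real (positions_below A n)"
proof -
  have free: "positions_below A (e i) + (n - e i) \<le> positions_below A n" if "e i \<le> n" "n \<le> m i" for i n
    using that A[of i] by (intro positions_below_ge) auto
  have at_e: "s * real (e i) - C \<le> real (positions_below A (e i))" for i
  proof (cases i)
    case 0
    then show ?thesis
      using assms by simp
  next
    case (Suc k)
    have "m k - e k \<le> positions_below A (m k)"
      using free[of k "m k"] assms by simp
    also have "\<dots> \<le> positions_below A (e i)"
      using assms(3)[of k] by (intro positions_below_mono) (simp add: Suc)
    finally show ?thesis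
      using gain[of k] by (simp add: Suc)
  qed
  have "strict_mono e"
    using assms(2,3) by (intro strict_mono_Suc_iff[THEN iffD2]) (meson le_less_trans)
  then have "n < e (Suc n)"
    by (meson Suc_le_lessD strict_mono_imp_increasing)
  \<comment> \<open>The index of the piece from \<open>e i\<close> to \<open>e (Suc i)\<close> that
    contains \<open>n\<close>.\<close>
  define i where "i = (LEAST i. n < e (Suc i))"
  have "n < e (Suc i)"
    unfolding i_def using \<open>n < e (Suc n)\<close> by (rule LeastI)
  moreover have "e i \<le> n"
  proof (cases i)
    case (Suc k)
    then show ?thesis
      using not_less_Least[of k "\<lambda>i. n < e (Suc i)"] by (simp add: i_def)
  qed (simp add: \<open>e 0 = 0\<close>)
  ultimately have i: "e i \<le> n" "n < e (Suc i)"
    by auto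
  show ?thesis
  proof (cases "n \<le> m i")
    case True
    have "s * real n - C = s * real (e i) - C + s * real (n - e i)"
      using i by (simp add: of_nat_diff algebra_simps)
    also have "\<dots> \<le> real (positions_below A (e i)) + 1 * real (n - e i)"
      using assms by (intro add_mono at_e mult_right_mono) auto
    also have "\<dots> = real (positions_below A (e i) + (n - e i))"
      by simp
    also have "\<dots> \<le> real (positions_below A n)"
      using free[OF i(1) True] by (simp only: of_nat_le_iff)
    finally show ?thesis .
  next
    case False
    have "s * real n - C \<le> s * real (e (Suc i)) - C"
      using i \<open>0 \<le> s\<close> by (intro diff_right_mono mult_left_mono) auto
    also have "\<dots> \<le> real (m i - e i)"
      by (rule gain)
    also have "m i - e i \<le> positions_below A (m i)"
      using free[of i "m i"] assms by simp
    also have "\<dots> \<le> positions_below A n"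
      using False by (intro positions_below_mono) simp
    finally show ?thesis
      by simp
  qed
qed

text \<open>The blocks of forced zeros are those that put \<open>spread A u\<close> within \<open>2 ^ -((k + 1) * t)\<close> of the
  grid of mesh \<open>2 ^ -\<lfloor>k * \<delta>\<rfloor>\<close>, for \<open>k\<close> running through the powers of a large \<open>L\<close>.\<close>

lemma ex_free_positions:
  fixes \<delta> t s :: real
  assumes "1 \<le> \<delta>" "\<delta> \<le> t" "0 < s" "s * t < \<delta>"
  obtains A C where "\<And>n. s * real n - C \<le> real (positions_below A n)"
    "\<And>N. \<exists>k>N. \<forall>j. nat \<lfloor>real k * \<delta>\<rfloor> \<le> j \<longrightarrow> j < nat \<lceil>real (k + 1) * t\<rceil> \<longrightarrow> \<not> A j"
proof -
  \<comment> \<open>The first bound makes each block end before the next one begins. The second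
    gives \<open>t \<le> L * (\<delta> - s * t)\<close>, so that the positions lost up to the end of
    one block are outweighed by the free stretch after it.\<close>
  define L where "L = max (nat \<lceil>2 * t + 3\<rceil>) (nat \<lceil>t / (\<delta> - s * t)\<rceil>)"
  have L: "2 * t + 3 \<le> real L" "t / (\<delta> - s * t) \<le> real L"
    unfolding L_def by linarith+
  then have L2: "t \<le> real L * (\<delta> - s * t)"
    using assms by (simp add: pos_divide_le_eq)
  have "1 < L"
    using L(1) assms by linarith
  define m where "m i = nat \<lfloor>real (L ^ i) * \<delta>\<rfloor>" for i
  define b where "b i = nat \<lceil>real (L ^ i + 1) * t\<rceil>" for i
  \<comment> \<open>Block \<open>i\<close> consists of the positions from \<open>m i\<close> up to
    but excluding \<open>b i\<close>; the next free stretch starts at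
    \<open>e (Suc i) = b i\<close>.\<close>
  define e where "e i = (case i of 0 \<Rightarrow> 0 | Suc i \<Rightarrow> b i)" for i
  define A where "A j \<longleftrightarrow> \<not> (\<exists>i. m i \<le> j \<and> j < b i)" for j
  \<comment> \<open>Absorbs the rounding in \<open>m\<close> and \<open>b\<close> and the summand
    \<open>t\<close> in the length of a block.\<close>
  define C where "C = 2 * t + 4"
  have kpos: "1 \<le> real (L ^ i)" for i
    using \<open>1 < L\<close> by (simp del: of_nat_power)
  have m_le: "real (m i) \<le> real (L ^ i) * \<delta>" and m_ge: "real (L ^ i) * \<delta> - 1 \<le> real (m i)" for i
    using kpos[of i] assms unfolding m_def by (simp_all del: of_nat_power)
  have b_ge: "real (L ^ i) * t + t \<le> real (b i)" and b_le: "real (b i) \<le> real (L ^ i) * t + t + 1" for i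
    using kpos[of i] assms unfolding b_def by (simp_all add: algebra_simps del: of_nat_power) linarith+
  have "s < 1"
  proof (rule ccontr)
    assume "\<not> s < 1"
    then have "1 * t \<le> s * t"
      using assms by (intro mult_right_mono) auto
    then show False
      using assms by linarith
  qed
  have "m i < b i" for i
  proof -
    have "real (L ^ i) * \<delta> \<le> real (L ^ i) * t"
      using assms by (intro mult_left_mono) auto
    then show ?thesis
      using m_le[of i] b_ge[of i] assms by linarith
  qed
  then have m_less_e: "m i < e (Suc i)" for i
    by (simp add: e_def)
  have e_le_m: "e i \<le> m i" for i
  proof (cases i)
    case (Suc k)
    have "real (L ^ k) * (2 * t + 3) * 1 \<le> real (L ^ k) * real L * \<delta>"
      using L assms by (intro mult_mono) auto
    moreover have "1 * (t + 3) \<le> real (L ^ k) * (t + 3)"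
      using kpos[of k] assms by (intro mult_right_mono) auto
    ultimately have "real (L ^ k) * t + t + 1 \<le> real (L ^ i) * \<delta> - 1"
      by (simp add: Suc algebra_simps)
    then show ?thesis
      using b_le[of k] m_ge[of i] by (simp add: Suc e_def)
  qed (simp add: e_def)
  have "mono m"
    unfolding mono_iff_le_Suc using e_le_m m_less_e by (meson le_less_trans less_imp_le order_trans)
  have "mono b"
    unfolding mono_iff_le_Suc
  proof
    fix i
    have "b i \<le> m (Suc i)"
      using e_le_m[of "Suc i"] by (simp add: e_def)
    also have "\<dots> < b (Suc i)"
      by fact
    finally show "b i \<le> b (Suc i)"
      by simp
  qed
  have dens: "s * real n - C \<le> real (positions_below A n)" for n
  proof (rule positions_below_density[of e m])
    show "s * real (e (Suc i)) - C \<le> real (m i - e i)" for i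
    proof -
      have "real (e i) + real (L ^ i) * (s * t) \<le> real (L ^ i) * \<delta> + t + 1"
      proof (cases i)
        case (Suc k)
        have "real (L ^ k) * t \<le> real (L ^ k) * (real L * (\<delta> - s * t))"
          using L2 by (intro mult_left_mono) auto
        then show ?thesis
          using b_le[of k] by (simp add: Suc e_def algebra_simps)
      qed (use assms in \<open>simp add: e_def\<close>)
      moreover have "s * real (b i) \<le> s * (real (L ^ i) * t + t + 1)"
        using b_le assms by (intro mult_left_mono) auto
      moreover have "s * (t + 1) \<le> 1 * (t + 1)"
        using \<open>s < 1\<close> assms by (intro mult_right_mono) auto
      ultimately show ?thesis
        using m_ge[of i] e_le_m[of i] by (simp add: e_def C_def of_nat_diff algebra_simps)
    qed
    \<comment> \<open>Earlier blocks end by \<open>e i\<close>; block \<open>i\<close> and the later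
      ones start at \<open>m i\<close> or beyond.\<close>
    show "A j" if "e i \<le> j" "j < m i" for i j
      unfolding A_def
    proof safe
      fix k
      assume k: "m k \<le> j" "j < b k"
      show False
      proof (cases "k < i")
        case True
        then obtain l where l: "i = Suc l" "k \<le> l"
          by (metis less_Suc_eq_le not0_implies_Suc not_less0)
        then show False
          using monoD[OF \<open>mono b\<close> l(2)] that k by (simp add: e_def)
      next
        case False
        then show False
          using monoD[OF \<open>mono m\<close>, of i k] that k by simp
      qed
    qed
  qed (use assms \<open>s < 1\<close> e_le_m m_less_e in \<open>auto simp: e_def C_def\<close>)
  show thesis
  proof (rule that[OF dens])
    fix N
    have "N < L ^ N"
      using \<open>1 < L\<close> by (simp add: power_gt_expt)
    moreover have "\<not> A j" if "nat \<lfloor>real (L ^ N) * \<delta>\<rfloor> \<le> j" "j < nat \<lceil>real (L ^ N + 1) * t\<rceil>" for j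
      using that unfolding A_def m_def b_def by blast
    ultimately show "\<exists>k>N. \<forall>j. nat \<lfloor>real k * \<delta>\<rfloor> \<le> j \<longrightarrow> j < nat \<lceil>real (k + 1) * t\<rceil> \<longrightarrow> \<not> A j"
      by blast
  qed
qed

section \<open>Abstract rationals in the unit interval\<close>

text \<open>By maximality, adding \<open>x\<close> destroys the separation, and a pair that violates
  it must involve \<open>x\<close>.\<close>

lemma ex_close_point:
  assumes "maximal_separated F r A" "0 < r" "x \<in> F"
  shows "\<exists>p\<in>A. dist p x < r"
proof (cases "x \<in> A")
  case False
  with assms have "\<not> separated r (insert x A)" "separated r A"
    by (auto simp: maximal_separated_def)
  then obtain a b where ab: "a \<in> insert x A" "b \<in> insert x A" "a \<noteq> b" "dist a b < r"
    by (force simp: separated_def)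
  with \<open>separated r A\<close> have "a = x \<and> b \<in> A \<or> b = x \<and> a \<in> A"
    by (auto simp: separated_def not_le[symmetric])
  with ab show ?thesis
    by (auto simp: dist_commute)
qed (use assms(2) in \<open>auto intro: bexI[of _ x]\<close>)

text \<open>The map \<open>\<lfloor>q * x\<rfloor>\<close> is injective on \<open>A\<close>, since
  points with the same value are less than \<open>1 / q\<close> apart, and it takes at most
  \<open>q + 1\<close> values.\<close>

lemma card_separated_unit_interval:
  fixes A :: "real set"
  assumes "separated (1 / real q) A" "A \<subseteq> {0..1}" "1 \<le> q"
  shows "finite A" "card A \<le> q + 1"
proof -
  define f where "f x = \<lfloor>real q * x\<rfloor>" for x
  have "inj_on f A"
  proof (rule inj_onI, rule ccontr)
    fix x y
    assume xy: "x \<in> A" "y \<in> A" "f x = f y" "x \<noteq> y"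
    then have "1 / real q \<le> \<bar>x - y\<bar>"
      using assms(1) by (auto simp: separated_def dist_real_def)
    then have "1 \<le> real q * \<bar>x - y\<bar>"
      using \<open>1 \<le> q\<close> by (simp add: field_simps)
    also have "\<dots> = \<bar>real q * x - real q * y\<bar>"
      by (simp add: abs_mult flip: right_diff_distrib)
    finally show False
      using \<open>f x = f y\<close> unfolding f_def by linarith
  qed
  moreover have "f ` A \<subseteq> {0..int q}"
  proof
    fix z
    assume "z \<in> f ` A"
    then obtain x where x: "x \<in> A" "z = f x"
      by blast
    then have "0 \<le> real q * x" "real q * x \<le> real q * 1"
      using assms by (auto intro!: mult_left_mono)
    then show "z \<in> {0..int q}"
      unfolding x f_def atLeastAtMost_iff by (simp add: floor_le_iff le_floor_iff)
  qed
  ultimately show "finite A" "card A \<le> q + 1"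
    using card_inj_on_le[of f A "{0..int q}"] by (auto intro: inj_on_finite)
qed

lemma hausdorff_measure_1_well_approximable:
  fixes P :: "nat \<Rightarrow> real set"
  assumes "abstract_rationals {0..1} P" "2 < t"
  shows "hausdorff_measure 1 (well_approximable {0..1} P t) = 0"
proof -
  have "\<exists>g. P q \<subseteq> g ` {..<q + 1}" if "1 \<le> q" for q
  proof -
    have "separated (1 / real q) (P q)" "P q \<subseteq> {0..1}"
      using assms that by (auto simp: abstract_rationals_def maximal_separated_def)
    note card = card_separated_unit_interval[OF this that]
    then obtain g where "bij_betw g {0..<card (P q)} (P q)"
      using ex_bij_betw_nat_finite by blast
    then have "P q = g ` {0..<card (P q)}"
      by (simp add: bij_betw_def)
    also have "\<dots> \<subseteq> g ` {..<q + 1}"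
      using card(2) by (intro image_mono) auto
    finally show ?thesis
      by blast
  qed
  then obtain g where g: "\<And>q. 1 \<le> q \<Longrightarrow> P q \<subseteq> g q ` {..<q + 1}"
    by metis
  show ?thesis
  proof (rule hausdorff_cantelli)
    show "(\<lambda>q. 1 / real q powr t) \<longlonglongrightarrow> 0"
      using \<open>2 < t\<close> tendsto_neg_powr[OF _ filterlim_real_sequentially, of "- t"]
      by (simp add: powr_minus divide_inverse)
    show "summable (\<lambda>q. real (q + 1) * (2 * (1 / real q powr t)) powr 1)"
    proof (rule summable_comparison_test')
      show "summable (\<lambda>q. 4 * real q powr (1 - t))"
        using \<open>2 < t\<close> by (intro summable_mult) (simp add: summable_real_powr_iff)
      fix q :: nat
      assume "1 \<le> q"
      then have "real (q + 1) * (2 * (1 / real q powr t)) \<le> (2 * real q) * (2 * (1 / real q powr t))"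
        by (intro mult_right_mono) auto
      then show "norm (real (q + 1) * (2 * (1 / real q powr t)) powr 1) \<le> 4 * real q powr (1 - t)"
        using \<open>1 \<le> q\<close> by (simp add: powr_diff)
    qed
    show "well_approximable {0..1} P t
        \<subseteq> (\<Union>q\<in>{K<..}. \<Union>j\<in>{..<q + 1}. cball (g q j) (1 / real q powr t))" for K
    proof
      fix x
      assume "x \<in> well_approximable {0..1} P t"
      then obtain q p where "q > K" "p \<in> P q" "x \<in> cball p (1 / real q powr t)"
        unfolding well_approximable_def by blast
      with g[of q] show "x \<in> (\<Union>q\<in>{K<..}. \<Union>j\<in>{..<q + 1}. cball (g q j) (1 / real q powr t))"
        by fastforce
    qed
  qed simp_all
qed

section \<open>Bounds for the Dirichlet exponent\<close>

text \<open>For \<open>\<delta> > D\<close> a ball that is null outside a null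
  \<open>F\<^sub>\<delta>\<close> would be null itself, but every ball contains a nondegenerate
  interval.\<close>

lemma dirichlet_exponent_leI:
  assumes "0 \<le> D" "\<And>\<delta>. D < \<delta> \<Longrightarrow> hausdorff_measure 1 (well_approximable {0..1} P \<delta>) = 0"
  shows "dirichlet_exponent 1 {0..1::real} P \<le> ereal D"
  unfolding dirichlet_exponent_def
proof (rule Sup_least)
  fix y
  assume "y \<in> ereal ` {\<delta>. 0 < \<delta> \<and> (\<exists>x\<in>{0..1}. \<exists>r>0.
    hausdorff_measure 1 ((cball x r \<inter> {0..1}) - well_approximable {0..1} P \<delta>) = 0)}"
  then obtain \<delta> x r where y: "y = ereal \<delta>" and x: "x \<in> {0..1::real}" and "0 < r"
    and zero: "hausdorff_measure 1 ((cball x r \<inter> {0..1}) - well_approximable {0..1} P \<delta>) = 0"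
    by blast
  have "\<delta> \<le> D"
  proof (rule ccontr)
    assume "\<not> \<delta> \<le> D"
    then have "negligible (well_approximable {0..1} P \<delta>)"
      by (intro negligible_if_hausdorff_measure_1_zero assms) simp
    with negligible_if_hausdorff_measure_1_zero[OF zero]
    have "negligible ((cball x r \<inter> {0..1} - well_approximable {0..1} P \<delta>)
        \<union> well_approximable {0..1} P \<delta>)"
      by (rule negligible_Un)
    \<comment> \<open>Clipping at 0 and 1 keeps the interval inside the ball of \<open>F\<close>; it
      is nondegenerate even if \<open>x\<close> is an end point.\<close>
    moreover have "cbox (max 0 (x - r)) (min 1 (x + r)) \<subseteq> cball x r \<inter> {0..1}"
      by (auto simp: dist_real_def)
    ultimately have "negligible (cbox (max 0 (x - r)) (min 1 (x + r)))"
      by (blast intro: negligible_subset)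
    moreover have "box (max 0 (x - r)) (min 1 (x + r)) \<noteq> {}"
      using x \<open>0 < r\<close> by (auto simp: box_real max_def min_def)
    ultimately show False
      by (simp only: negligible_interval)
  qed
  then show "y \<le> ereal D"
    by (simp add: y)
qed

lemma dirichlet_exponent_geI:
  assumes "0 < \<delta>" "{0..1} \<subseteq> well_approximable {0..1} P \<delta>"
  shows "ereal \<delta> \<le> dirichlet_exponent 1 {0..1::real} P"
proof -
  have "hausdorff_measure 1 (cball 0 1 \<inter> {0..1} - well_approximable {0..1} P \<delta>) = 0"
    using assms(2) by (subst Diff_eq_empty_iff[THEN iffD2]) auto
  then show ?thesis
    unfolding dirichlet_exponent_def using \<open>0 < \<delta>\<close>
    by (intro Sup_upper imageI CollectI conjI bexI[of _ 0] exI[of _ 1]) auto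
qed

lemma dirichlet_exponent_bounds:
  assumes "abstract_rationals {0..1::real} P"
  shows "1 \<le> dirichlet_exponent 1 {0..1} P" "dirichlet_exponent 1 {0..1} P \<le> 2"
proof -
  have "{0..1} \<subseteq> well_approximable {0..1} P 1"
    unfolding well_approximable_def
  proof safe
    fix x :: real and N
    assume x: "x \<in> {0..1}"
    have "maximal_separated {0..1} (1 / real (Suc N)) (P (Suc N))"
      using assms unfolding abstract_rationals_def by (metis Suc_eq_plus1 le_add2)
    from ex_close_point[OF this _ x] obtain p where "p \<in> P (Suc N)" "dist p x < 1 / real (Suc N)"
      by auto
    with x show "x \<in> (\<Union>q\<in>{N<..}. \<Union>p\<in>P q. cball p (1 / real q powr 1) \<inter> {0..1})"
      by (intro UN_I[of "Suc N"] UN_I[of p]) auto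
  qed
  then show "1 \<le> dirichlet_exponent 1 {0..1} P"
    using dirichlet_exponent_geI[of 1 P] by (simp add: one_ereal_def)
  show "dirichlet_exponent 1 {0..1} P \<le> 2"
    using dirichlet_exponent_leI[of 2] hausdorff_measure_1_well_approximable[OF assms] by simp
qed

section \<open>Maximal separated sets from dyadic grids\<close>

text \<open>End points are added exactly when they are far from \<open>G\<close>. A further point
  \<open>x\<close> would be at distance at least \<open>r\<close> from both neighbours
  \<open>a\<close> and \<open>b\<close>, although their gap is shorter than
  \<open>2 * r\<close>.\<close>

lemma maximal_separated_add_endpoints:
  fixes G :: "real set"
  assumes "G \<subseteq> {0..1}" "separated r G" "r \<le> 1"
    and gap: "\<And>x. x \<in> {0..1} \<Longrightarrow> \<exists>a\<in>insert 0 G. \<exists>b\<in>insert 1 G. a \<le> x \<and> x \<le> b \<and> b - a < 2 * r"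
  shows "maximal_separated {0..1} r (G \<union> {e \<in> {0, 1}. \<forall>p\<in>G. r \<le> dist e p})"
    (is "maximal_separated _ _ ?P")
  unfolding maximal_separated_def
proof (intro conjI ballI notI)
  show "?P \<subseteq> {0..1}"
    using assms(1) by auto
  show "separated r ?P"
    using assms(2,3) by (auto simp: separated_def dist_real_def abs_minus_commute)
  fix x
  assume x: "x \<in> {0..1} - ?P" and sep: "separated r (insert x ?P)"
  have far: "r \<le> \<bar>x - p\<bar>" if "p \<in> ?P" for p
  proof -
    have "x \<noteq> p"
      using that x by blast
    with sep[unfolded separated_def, rule_format, OF insertI1 insertI2[OF that]] show ?thesis
      by (simp add: dist_real_def)
  qed
  obtain a b where ab: "a \<in> insert 0 G" "b \<in> insert 1 G" "a \<le> x" "x \<le> b" "b - a < 2 * r"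
    using gap[of x] x by blast
  have "r \<le> x - a"
  proof (cases "a \<in> ?P")
    case True
    then have "r \<le> \<bar>x - a\<bar>"
      by (rule far)
    with ab show ?thesis
      by simp
  next
    case False
    \<comment> \<open>Here 0 was left out because some \<open>p\<close> in \<open>G\<close> is
      closer than \<open>r\<close> to it. Then \<open>x\<close> cannot lie below \<open>p\<close>,
      so it lies at least \<open>r\<close> above \<open>p\<close> and hence above 0.\<close>
    with ab obtain p where p: "a = 0" "p \<in> G" "\<not> r \<le> dist a p"
      by blast
    then have "r \<le> \<bar>x - p\<bar>" "p \<in> {0..1}"
      using far[of p] assms(1) by blast+
    with p ab show ?thesis
      by (auto simp: dist_real_def abs_if split: if_splits)
  qed
  moreover have "r \<le> b - x"
  proof (cases "b \<in> ?P")
    case True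
    then have "r \<le> \<bar>x - b\<bar>"
      by (rule far)
    with ab show ?thesis
      by simp
  next
    case False
    with ab obtain p where p: "b = 1" "p \<in> G" "\<not> r \<le> dist b p"
      by blast
    then have "r \<le> \<bar>x - p\<bar>" "p \<in> {0..1}"
      using far[of p] assms(1) by blast+
    with p ab show ?thesis
      by (auto simp: dist_real_def abs_if split: if_splits)
  qed
  ultimately show False
    using ab by simp
qed

text \<open>A translate of the coarse grid of mesh \<open>M / 2 ^ m\<close>. As \<open>q\<close>
  runs through the residues modulo \<open>M\<close>, these translates partition the fine grid of
  mesh \<open>1 / 2 ^ m\<close>.\<close>

definition residue_grid :: "nat \<Rightarrow> nat \<Rightarrow> nat \<Rightarrow> real set" where
  "residue_grid m M q = (\<lambda>j. real j / 2 ^ m) ` {j. j \<le> 2 ^ m \<and> j mod M = q mod M}"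

lemma separated_residue_grid:
  assumes "0 < M"
  shows "separated (real M / 2 ^ m) (residue_grid m M q)"
proof -
  have *: "real M \<le> real j - real i" if "i mod M = q mod M" "j mod M = q mod M" "i < j" for i j
  proof -
    have "M dvd j - i"
      using that by (metis mod_eq_dvd_iff_nat less_imp_le)
    then have "M \<le> j - i"
      using that by (intro dvd_imp_le) auto
    with \<open>i < j\<close> show ?thesis
      by linarith
  qed
  have "real M / 2 ^ m \<le> \<bar>real i / 2 ^ m - real j / 2 ^ m\<bar>"
    if "i mod M = q mod M" "j mod M = q mod M" "i \<noteq> j" for i j
  proof -
    have "real M \<le> \<bar>real i - real j\<bar>"
      using *[of i j] *[of j i] that by (cases "i < j") auto
    then have "real M / 2 ^ m \<le> \<bar>real i - real j\<bar> / 2 ^ m"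
      by (intro divide_right_mono) auto
    then show ?thesis
      by (simp flip: diff_divide_distrib)
  qed
  then show ?thesis
    by (fastforce simp: separated_def residue_grid_def dist_real_def)
qed

text \<open>Consecutive admissible indices differ by \<open>M\<close>; 0 or 1 takes the place of a
  neighbour when \<open>x\<close> lies before the first or after the last of them.\<close>

lemma residue_grid_gap:
  assumes "0 < M" "M \<le> 2 ^ m" "x \<in> {0..1}"
  shows "\<exists>a\<in>insert 0 (residue_grid m M q). \<exists>b\<in>insert 1 (residue_grid m M q).
    a \<le> x \<and> x \<le> b \<and> b - a \<le> real M / 2 ^ m"
proof -
  define f where "f = nat \<lfloor>x * 2 ^ m\<rfloor>"
  define r where "r = q mod M"
  have "0 \<le> x * 2 ^ m"
    using assms by simp
  then have f: "real f \<le> x * 2 ^ m" "x * 2 ^ m < real f + 1"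
    unfolding f_def by linarith+
  have "x * 2 ^ m \<le> 1 * 2 ^ m"
    using assms by (intro mult_right_mono) auto
  then have "real f \<le> 2 ^ m"
    using f by linarith
  then have "f \<le> 2 ^ m"
    by simp
  have "r < M"
    using assms by (simp add: r_def)
  show ?thesis
  proof (cases "r \<le> f")
    case True
    \<comment> \<open>The largest index up to \<open>f\<close> in the required residue
      class.\<close>
    define j where "j = r + M * ((f - r) div M)"
    have j: "j \<le> f" "f < j + M"
      using True \<open>0 < M\<close> mult_div_mod_eq[of M "f - r"] mod_less_divisor[of M "f - r"]
      unfolding j_def by linarith+
    have "j mod M = q mod M"
      by (simp add: j_def r_def)
    then have a: "real j / 2 ^ m \<in> residue_grid m M q"
      using j \<open>f \<le> 2 ^ m\<close> by (auto simp: residue_grid_def)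
    have "real j \<le> x * 2 ^ m"
      using j f by linarith
    then have ax: "real j / 2 ^ m \<le> x"
      by (simp add: field_simps)
    show ?thesis
    proof (cases "j + M \<le> 2 ^ m")
      case True
      have "real (j + M) / 2 ^ m \<in> residue_grid m M q"
        using True \<open>j mod M = q mod M\<close> unfolding residue_grid_def by (intro imageI) auto
      moreover have "x * 2 ^ m \<le> real (j + M)"
        using j f by linarith
      then have "x \<le> real (j + M) / 2 ^ m"
        by (simp add: field_simps)
      ultimately show ?thesis
        using a ax by (intro bexI[of _ "real j / 2 ^ m"] bexI[of _ "real (j + M) / 2 ^ m"])
          (auto simp: add_divide_distrib)
    next
      case False
      then have "real (2 ^ m) \<le> real (j + M)"
        by (simp only: of_nat_le_iff)
      then have "real (2 ^ m) / 2 ^ m \<le> real (j + M) / 2 ^ m"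
        by (rule divide_right_mono) simp
      then have "1 - real j / 2 ^ m \<le> real M / 2 ^ m"
        by (simp add: add_divide_distrib)
      then show ?thesis
        using a ax assms by (intro bexI[of _ "real j / 2 ^ m"] bexI[of _ 1]) auto
    qed
  next
    case False
    have "r mod M = q mod M" "r \<le> 2 ^ m"
      using \<open>r < M\<close> assms(2) by (simp add: r_def, linarith)
    then have "real r / 2 ^ m \<in> residue_grid m M q"
      unfolding residue_grid_def by (intro imageI) auto
    moreover have "x * 2 ^ m \<le> real r"
      using False f by linarith
    then have "x \<le> real r / 2 ^ m"
      by (simp add: field_simps)
    moreover have "real r / 2 ^ m \<le> real M / 2 ^ m"
      using \<open>r < M\<close> by (intro divide_right_mono) auto
    ultimately show ?thesis
      using assms by (intro bexI[of _ 0] bexI[of _ "real r / 2 ^ m"]) auto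
  qed
qed

text \<open>For \<open>2 ^ k \<le> q < 2 ^ (k + 1)\<close> the multiples of \<open>2 ^ -k\<close>, suitably shifted, form a maximal
  \<open>1 / q\<close>-separated set up to the end points. As \<open>q\<close> runs through this block, \<open>2 ^ (m - k)\<close>
  equidistant shifts are used, where \<open>m = \<lfloor>k * \<delta>\<rfloor>\<close>; together they form the grid of mesh \<open>2 ^ -m\<close>.\<close>

definition grid_level :: "real \<Rightarrow> nat \<Rightarrow> nat" where
  "grid_level \<delta> k = nat \<lfloor>real k * \<delta>\<rfloor>"

definition shifted_rationals :: "real \<Rightarrow> nat \<Rightarrow> real set" where
  "shifted_rationals \<delta> q =
     (let k = floor_log q; m = grid_level \<delta> k; G = residue_grid m (2 ^ (m - k)) q
      in G \<union> {e \<in> {0, 1}. \<forall>p\<in>G. 1 / real q \<le> dist e p})"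

lemma grid_level_bounds:
  assumes "1 \<le> \<delta>"
  shows "real (grid_level \<delta> k) \<le> real k * \<delta>" "real k * \<delta> - 1 < real (grid_level \<delta> k)"
    "k \<le> grid_level \<delta> k"
proof -
  have "real k * 1 \<le> real k * \<delta>"
    using assms by (intro mult_left_mono) auto
  then show "real (grid_level \<delta> k) \<le> real k * \<delta>" "real k * \<delta> - 1 < real (grid_level \<delta> k)"
    "k \<le> grid_level \<delta> k"
    unfolding grid_level_def by linarith+
qed

text \<open>For \<open>q\<close> in block \<open>k\<close> the mesh \<open>1 / 2 ^ k\<close> is at
  least \<open>1 / q\<close>, which gives separation, and less than \<open>2 / q\<close>, which
  leaves no room for another point.\<close>

lemma abstract_rationals_shifted:
  assumes "1 \<le> \<delta>"
  shows "abstract_rationals {0..1} (shifted_rationals \<delta>)"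
  unfolding abstract_rationals_def
proof (intro allI impI)
  fix q :: nat
  assume "1 \<le> q"
  define k where "k = floor_log q"
  define m where "m = grid_level \<delta> k"
  define G where "G = residue_grid m (2 ^ (m - k)) q"
  have "k \<le> m"
    unfolding m_def by (rule grid_level_bounds) fact
  then have mesh: "real (2 ^ (m - k)) / 2 ^ m = 1 / 2 ^ k"
    by (simp only: of_nat_power of_nat_numeral) (simp add: power_diff)
  have "2 ^ k \<le> q" "q < 2 * 2 ^ k"
    using floor_log_exp2_le[of q] floor_log_exp2_gt[of q] \<open>1 \<le> q\<close> by (auto simp: k_def)
  then have "real (2 ^ k) \<le> real q" "real q < real (2 * 2 ^ k)"
    by (simp_all only: of_nat_le_iff of_nat_less_iff)
  then have q: "1 / real q \<le> 1 / 2 ^ k" "1 / 2 ^ k < 2 * (1 / real q)"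
    using \<open>1 \<le> q\<close> by (auto simp: field_simps)
  have "maximal_separated {0..1} (1 / real q) (G \<union> {e \<in> {0, 1}. \<forall>p\<in>G. 1 / real q \<le> dist e p})"
  proof (rule maximal_separated_add_endpoints)
    show "G \<subseteq> {0..1}"
      by (auto simp: G_def residue_grid_def)
    have "separated (1 / 2 ^ k) G"
      using separated_residue_grid[of "2 ^ (m - k)" m q] unfolding G_def mesh by simp
    with q(1) show "separated (1 / real q) G"
      unfolding separated_def by (meson order_trans)
    show "1 / real q \<le> 1"
      using \<open>1 \<le> q\<close> by simp
    show "\<exists>a\<in>insert 0 G. \<exists>b\<in>insert 1 G. a \<le> x \<and> x \<le> b \<and> b - a < 2 * (1 / real q)"
      if x: "x \<in> {0..1}" for x
    proof -
      have "\<exists>a\<in>insert 0 G. \<exists>b\<in>insert 1 G. a \<le> x \<and> x \<le> b \<and> b - a \<le> 1 / 2 ^ k"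
        unfolding G_def mesh[symmetric] using x
        by (intro residue_grid_gap) (auto intro: power_increasing)
      then obtain a b where "a \<in> insert 0 G" "b \<in> insert 1 G" "a \<le> x" "x \<le> b" "b - a \<le> 1 / 2 ^ k"
        by blast
      with q(2) show ?thesis
        by (intro bexI[of _ a] bexI[of _ b]) auto
    qed
  qed
  then show "maximal_separated {0..1} (1 / real q) (shifted_rationals \<delta> q)"
    by (simp add: shifted_rationals_def k_def m_def G_def Let_def)
qed

lemma shifted_rationals_subset_grid:
  "shifted_rationals \<delta> q \<subseteq> (\<lambda>j. real j / 2 ^ grid_level \<delta> (floor_log q)) ` {..2 ^ grid_level \<delta> (floor_log q)}"
proof -
  have "0 \<in> (\<lambda>j. real j / 2 ^ m) ` {..2 ^ m}" "1 \<in> (\<lambda>j. real j / 2 ^ m) ` {..2 ^ m}" for m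
    by (auto intro: image_eqI[of _ _ 0] image_eqI[of _ _ "2 ^ m"])
  then show ?thesis
    by (auto simp: shifted_rationals_def Let_def residue_grid_def)
qed

lemma ex_shifted_rationals:
  assumes "1 \<le> \<delta>" "\<delta> \<le> 2" "j \<le> 2 ^ grid_level \<delta> k"
  shows "\<exists>q\<ge>2 ^ k. q < 2 ^ (k + 1) \<and> real j / 2 ^ grid_level \<delta> k \<in> shifted_rationals \<delta> q"
proof -
  define m where "m = grid_level \<delta> k"
  define M :: nat where "M = 2 ^ (m - k)"
  \<comment> \<open>From \<open>\<delta> \<le> 2\<close> follows \<open>m - k \<le> k\<close>, so
    \<open>M\<close> divides \<open>2 ^ k\<close>: this \<open>q\<close> stays in the block and has
    the residue of \<open>j\<close>.\<close>
  define q where "q = 2 ^ k + j mod M"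
  have "real k * \<delta> \<le> real k * 2"
    using assms by (intro mult_left_mono) auto
  then have "m - k \<le> k"
    using grid_level_bounds(1)[OF assms(1), of k] unfolding m_def by linarith
  then have "M dvd 2 ^ k"
    unfolding M_def by (rule le_imp_power_dvd)
  then have "M \<le> 2 ^ k" "q mod M = j mod M"
    by (auto simp: q_def dvd_imp_le mod_add_eq[symmetric, of "2 ^ k"])
  moreover have "j mod M < M"
    by (simp add: M_def)
  ultimately have q: "2 ^ k \<le> q" "q < 2 ^ (k + 1)"
    by (auto simp: q_def)
  then have "floor_log q = k"
    by (intro floor_log_eqI) auto
  then have "real j / 2 ^ m \<in> shifted_rationals \<delta> q"
    using assms(3) \<open>q mod M = j mod M\<close>
    by (auto simp: shifted_rationals_def Let_def residue_grid_def M_def m_def)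
  with q show ?thesis
    unfolding m_def by blast
qed

section \<open>Limsup sets of the shifted rationals\<close>

text \<open>The grid point belongs to some \<open>q < 2 ^ (k + 1)\<close>, whose ball has radius at
  least \<open>2 powr (- ((k + 1) * t))\<close>; this is why \<open>k + 1\<close> occurs in
  \<open>close\<close>.\<close>

lemma well_approximable_shiftedI:
  assumes "1 \<le> \<delta>" "\<delta> \<le> 2" "0 \<le> t" "x \<in> {0..1}"
    and close: "\<And>N. \<exists>k>N. \<exists>j\<le>2 ^ grid_level \<delta> k.
      \<bar>x - real j / 2 ^ grid_level \<delta> k\<bar> \<le> 2 powr (- (real (k + 1) * t))"
  shows "x \<in> well_approximable {0..1} (shifted_rationals \<delta>) t"
  unfolding well_approximable_def
proof
  fix N
  obtain k j where k: "N < k" and j: "j \<le> 2 ^ grid_level \<delta> k"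
    and x: "\<bar>x - real j / 2 ^ grid_level \<delta> k\<bar> \<le> 2 powr (- (real (k + 1) * t))"
    using close by blast
  obtain q where q: "2 ^ k \<le> q" "q < 2 ^ (k + 1)"
    "real j / 2 ^ grid_level \<delta> k \<in> shifted_rationals \<delta> q"
    using ex_shifted_rationals[OF assms(1,2) j] by blast
  have "k < 2 ^ k"
    by (rule less_exp)
  with k q have "N < q"
    by linarith
  then have "0 < real q"
    by simp
  have "real q \<le> real (2 ^ (k + 1))"
    using q(2) by (simp only: of_nat_le_iff)
  then have "real q powr t \<le> (2 powr real (k + 1)) powr t"
    using assms(3) by (intro powr_mono2) (auto simp: powr_realpow powr_add)
  then have "inverse ((2 powr real (k + 1)) powr t) \<le> inverse (real q powr t)"
    using \<open>0 < real q\<close> by (intro le_imp_inverse_le) auto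
  then have "2 powr (- (real (k + 1) * t)) \<le> 1 / real q powr t"
    by (simp only: powr_powr powr_minus inverse_eq_divide)
  with x have "x \<in> cball (real j / 2 ^ grid_level \<delta> k) (1 / real q powr t)"
    by (simp add: dist_real_def abs_minus_commute)
  with \<open>N < q\<close> q(3) assms(4) show "x \<in> (\<Union>q\<in>{N<..}. \<Union>p\<in>shifted_rationals \<delta> q.
      cball p (1 / real q powr t) \<inter> {0..1})"
    by blast
qed

text \<open>All \<open>q\<close> in block \<open>k\<close> share one grid of
  \<open>2 ^ grid_level \<delta> k + 1\<close> points and have radii at most
  \<open>2 powr (- t * k)\<close>. The covering sums are dominated by a geometric series of ratio
  \<open>2 powr (\<delta> - s * t) < 1\<close>.\<close>

lemma hausdorff_measure_shifted_zero:
  assumes "1 \<le> \<delta>" "0 < t" "0 < s" "\<delta> < s * t"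
  shows "hausdorff_measure s (well_approximable {0..1} (shifted_rationals \<delta>) t) = 0"
proof -
  define r where "r k = 2 powr (- t * real k)" for k
  have r: "r = (\<lambda>k. (2 powr (- t)) ^ k)"
    by (simp add: r_def fun_eq_iff powr_realpow[symmetric] powr_powr)
  show ?thesis
  proof (rule hausdorff_cantelli)
    have "2 powr (- t) < 1"
      using \<open>0 < t\<close> by (simp add: powr_less_one)
    then show "r \<longlonglongrightarrow> 0"
      unfolding r by (intro LIMSEQ_power_zero) simp
    show "summable (\<lambda>k. real (2 ^ grid_level \<delta> k + 1) * (2 * r k) powr s)"
    proof (rule summable_comparison_test')
      have "2 powr (\<delta> - s * t) < 1"
        using assms by (simp add: powr_less_one)
      then show "summable (\<lambda>k. (2 * 2 powr s) * (2 powr (\<delta> - s * t)) ^ k)"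
        by (intro summable_mult summable_geometric) simp
      fix k :: nat
      assume "0 \<le> k"
      have "real (2 ^ grid_level \<delta> k + 1) \<le> 2 * 2 powr real (grid_level \<delta> k)"
        by (simp add: powr_realpow)
      also have "\<dots> \<le> 2 * 2 powr (real k * \<delta>)"
        using grid_level_bounds(1)[OF assms(1)] by (intro mult_left_mono powr_mono) auto
      finally have "real (2 ^ grid_level \<delta> k + 1) * (2 * r k) powr s
          \<le> 2 * 2 powr (real k * \<delta>) * (2 * r k) powr s"
        by (intro mult_right_mono) auto
      also have "\<dots> = (2 * 2 powr s) * (2 powr (real k * \<delta>) * 2 powr (- s * t * real k))"
        by (simp add: r_def powr_mult powr_powr mult_ac)
      also have "\<dots> = (2 * 2 powr s) * (2 powr (\<delta> - s * t)) ^ k"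
        by (simp add: powr_realpow[symmetric] powr_powr algebra_simps flip: powr_add)
      finally show "norm (real (2 ^ grid_level \<delta> k + 1) * (2 * r k) powr s)
          \<le> (2 * 2 powr s) * (2 powr (\<delta> - s * t)) ^ k"
        by simp
    qed
    show "well_approximable {0..1} (shifted_rationals \<delta>) t \<subseteq> (\<Union>k\<in>{K<..}.
        \<Union>j\<in>{..<2 ^ grid_level \<delta> k + 1}. cball (real j / 2 ^ grid_level \<delta> k) (r k))" for K
    proof
      fix x
      assume "x \<in> well_approximable {0..1} (shifted_rationals \<delta>) t"
      \<comment> \<open>This threshold forces the block index \<open>k\<close> of \<open>q\<close>
        to exceed \<open>K\<close>.\<close>
      then obtain q p where q: "q > 2 * 2 ^ K" "p \<in> shifted_rationals \<delta> q"
          "dist p x \<le> 1 / real q powr t"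
        unfolding well_approximable_def by fastforce
      define k where "k = floor_log q"
      have k: "2 ^ k \<le> q" "q < 2 * 2 ^ k"
        using floor_log_exp2_le[of q] floor_log_exp2_gt[of q] q(1) by (auto simp: k_def)
      have "(2::nat) ^ K < 2 ^ k"
        using k(2) q(1) by linarith
      then have "K < k"
        by simp
      obtain j where j: "j \<le> 2 ^ grid_level \<delta> k" "p = real j / 2 ^ grid_level \<delta> k"
        using q(2) shifted_rationals_subset_grid unfolding k_def by blast
      have "real (2 ^ k) \<le> real q"
        using k(1) by (simp only: of_nat_le_iff)
      then have "2 powr real k \<le> real q"
        by (simp add: powr_realpow)
      then have "(2 powr real k) powr t \<le> real q powr t"
        using \<open>0 < t\<close> by (intro powr_mono2) auto
      then have "2 powr (t * real k) \<le> real q powr t"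
        by (simp add: powr_powr mult.commute)
      then have "1 / real q powr t \<le> 1 / 2 powr (t * real k)"
        by (intro frac_le) auto
      then have "dist p x \<le> r k"
        using q(3) by (simp add: r_def powr_minus divide_inverse)
      with j \<open>K < k\<close> show "x \<in> (\<Union>k\<in>{K<..}.
          \<Union>j\<in>{..<2 ^ grid_level \<delta> k + 1}. cball (real j / 2 ^ grid_level \<delta> k) (r k))"
        by (intro UN_I[of k] UN_I[of j]) auto
    qed
  qed (use assms in \<open>auto simp: r_def\<close>)
qed

lemma unit_interval_subset_well_approximable_shifted:
  assumes "1 \<le> \<delta>" "\<delta> \<le> 2" "0 < t" "t < \<delta>"
  shows "{0..1} \<subseteq> well_approximable {0..1} (shifted_rationals \<delta>) t"
proof
  fix x :: real
  assume x: "x \<in> {0..1}"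
  show "x \<in> well_approximable {0..1} (shifted_rationals \<delta>) t"
  proof (rule well_approximable_shiftedI)
    fix N
    \<comment> \<open>Large enough for \<open>(k + 1) * t \<le> k * \<delta> - 1\<close>, which puts
      the mesh of the grid below the tolerance.\<close>
    define k where "k = max (Suc N) (nat \<lceil>(1 + t) / (\<delta> - t)\<rceil>)"
    have k: "N < k" "(1 + t) / (\<delta> - t) \<le> real k"
      unfolding k_def by linarith+
    define m where "m = grid_level \<delta> k"
    define j where "j = nat \<lfloor>x * 2 ^ m\<rfloor>"
    have "0 \<le> x * 2 ^ m"
      using x by simp
    then have j: "real j \<le> x * 2 ^ m" "x * 2 ^ m < real j + 1"
      unfolding j_def by linarith+
    have "x * 2 ^ m \<le> 1 * 2 ^ m"
      using x by (intro mult_right_mono) auto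
    then have "real j \<le> 2 ^ m"
      using j by linarith
    then have "j \<le> 2 ^ m"
      by simp
    have "real (k + 1) * t \<le> real k * \<delta> - 1"
      using k(2) assms by (simp add: pos_divide_le_eq algebra_simps)
    also have "\<dots> \<le> real m"
      using grid_level_bounds(2)[OF assms(1), of k] by (simp add: m_def)
    finally have "2 powr (- real m) \<le> 2 powr (- (real (k + 1) * t))"
      by (intro powr_mono) auto
    moreover have "x - real j / 2 ^ m = (x * 2 ^ m - real j) / 2 ^ m"
      by (simp add: diff_divide_distrib)
    then have "\<bar>x - real j / 2 ^ m\<bar> \<le> 1 / 2 ^ m"
      using j by (simp add: abs_divide divide_right_mono)
    moreover have "1 / 2 ^ m = 2 powr (- real m)"
      by (simp add: powr_minus powr_realpow divide_inverse)
    ultimately have "\<bar>x - real j / 2 ^ m\<bar> \<le> 2 powr (- (real (k + 1) * t))"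
      by linarith
    with k(1) \<open>j \<le> 2 ^ m\<close> show "\<exists>k>N. \<exists>j\<le>2 ^ grid_level \<delta> k.
        \<bar>x - real j / 2 ^ grid_level \<delta> k\<bar> \<le> 2 powr (- (real (k + 1) * t))"
      unfolding m_def by blast
  qed (use assms x in auto)
qed

lemma dirichlet_exponent_shifted:
  assumes "1 \<le> \<delta>" "\<delta> \<le> 2"
  shows "dirichlet_exponent 1 {0..1} (shifted_rationals \<delta>) = ereal \<delta>"
proof (rule antisym)
  show "dirichlet_exponent 1 {0..1} (shifted_rationals \<delta>) \<le> ereal \<delta>"
    using assms by (intro dirichlet_exponent_leI hausdorff_measure_shifted_zero) auto
  show "ereal \<delta> \<le> dirichlet_exponent 1 {0..1} (shifted_rationals \<delta>)"
  proof (rule ereal_le_epsilon2)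
    fix e :: real
    assume "0 < e"
    \<comment> \<open>The value \<open>1 / 2\<close> keeps \<open>t\<close> positive for large
      \<open>e\<close> and is still below \<open>\<delta>\<close>.\<close>
    define t where "t = max (\<delta> - e) (1 / 2)"
    have "ereal t \<le> dirichlet_exponent 1 {0..1} (shifted_rationals \<delta>)"
      using assms \<open>0 < e\<close>
      by (intro dirichlet_exponent_geI unit_interval_subset_well_approximable_shifted) (auto simp: t_def)
    then have "ereal t + ereal e \<le> dirichlet_exponent 1 {0..1} (shifted_rationals \<delta>) + ereal e"
      by (rule add_right_mono)
    moreover have "\<delta> \<le> t + e"
      by (simp add: t_def)
    then have "ereal \<delta> \<le> ereal t + ereal e"
      by simp
    ultimately show "ereal \<delta> \<le> dirichlet_exponent 1 {0..1} (shifted_rationals \<delta>) + ereal e"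
      by (rule order_trans[rotated])
  qed
qed

text \<open>Otherwise the Hoelder inverse of \<open>spread A\<close> would make the parameter
  interval \<open>{0..<1}\<close> negligible.\<close>

lemma hausdorff_measure_shifted_nonzero:
  assumes "1 \<le> \<delta>" "\<delta> \<le> 2" "\<delta> \<le> t" "0 < s" "s * t < \<delta>"
  shows "hausdorff_measure s (well_approximable {0..1} (shifted_rationals \<delta>) t) \<noteq> 0"
proof
  assume zero: "hausdorff_measure s (well_approximable {0..1} (shifted_rationals \<delta>) t) = 0"
  obtain A C where dens: "\<And>n. s * real n - C \<le> real (positions_below A n)"
    and zeros: "\<And>N. \<exists>k>N. \<forall>j. nat \<lfloor>real k * \<delta>\<rfloor> \<le> j \<longrightarrow> j < nat \<lceil>real (k + 1) * t\<rceil> \<longrightarrow> \<not> A j"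
    by (rule ex_free_positions[OF assms(1,3,4,5)], rule that)
  have "spread A u \<in> well_approximable {0..1} (shifted_rationals \<delta>) t" for u
  proof (rule well_approximable_shiftedI)
    fix N
    obtain k where "N < k" and free: "\<And>j. grid_level \<delta> k \<le> j \<Longrightarrow> j < nat \<lceil>real (k + 1) * t\<rceil> \<Longrightarrow> \<not> A j"
      using zeros[of N] unfolding grid_level_def by blast
    define m where "m = grid_level \<delta> k"
    define n where "n = nat \<lceil>real (k + 1) * t\<rceil>"
    define j where "j = nat (spread_digits A u m)"
    have j: "real_of_int (spread_digits A u m) = real j" "j \<le> 2 ^ m"
      using spread_digits_bounds[of A u m] by (auto simp: j_def nat_le_iff)
    have "real k * \<delta> \<le> real (k + 1) * t"
      using assms by (intro mult_mono) auto
    then have "m \<le> n"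
      using grid_level_bounds(1)[OF assms(1), of k] unfolding m_def n_def by linarith
    then have "\<bar>spread A u - real_of_int (spread_digits A u m) / 2 ^ m\<bar> \<le> 1 / 2 ^ n"
      using free by (intro spread_close_to_grid) (auto simp: m_def n_def)
    then have "\<bar>spread A u - real j / 2 ^ m\<bar> \<le> 1 / 2 ^ n"
      by (simp only: j(1))
    also have "\<dots> = 2 powr (- real n)"
      by (simp add: powr_minus powr_realpow divide_inverse)
    also have "\<dots> \<le> 2 powr (- (real (k + 1) * t))"
      unfolding n_def by (intro powr_mono) linarith+
    finally show "\<exists>k>N. \<exists>j\<le>2 ^ grid_level \<delta> k.
        \<bar>spread A u - real j / 2 ^ grid_level \<delta> k\<bar> \<le> 2 powr (- (real (k + 1) * t))"
      using \<open>N < k\<close> j(2) unfolding m_def by blast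
  qed (use assms spread_in_unit_interval in auto)
  then have "negligible {0..<1::real}"
    using inverse_spread_hoelder[OF \<open>0 < s\<close> dens] \<open>0 < s\<close>
    by (intro negligible_if_hausdorff_measure_zero[OF zero, of "3 * 2 powr (C + s)" "spread A"])
      (auto simp: dist_real_def)
  then have "negligible (cbox 0 (1 / 2) :: real set)"
    by (rule negligible_subset) auto
  then show False
    by (simp only: negligible_interval) (simp add: box_real)
qed

lemma hausdorff_dim_shifted:
  assumes "1 \<le> \<delta>" "\<delta> \<le> 2" "\<delta> \<le> t"
  shows "hausdorff_dim (well_approximable {0..1} (shifted_rationals \<delta>) t) = ereal (\<delta> / t)"
proof (rule antisym)
  let ?F = "well_approximable {0..1} (shifted_rationals \<delta>) t"
  have "0 < t" "0 < \<delta> / t"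
    using assms by auto
  show "hausdorff_dim ?F \<le> ereal (\<delta> / t)"
  proof (rule ereal_le_epsilon2)
    fix e :: real
    assume "0 < e"
    have "\<delta> < (\<delta> / t + e) * t"
      using \<open>0 < t\<close> \<open>0 < e\<close> by (simp add: field_simps)
    moreover have "0 < \<delta> / t + e"
      using \<open>0 < \<delta> / t\<close> \<open>0 < e\<close> by (rule add_pos_pos)
    ultimately have "hausdorff_measure (\<delta> / t + e) ?F = 0"
      using \<open>0 < t\<close> assms by (intro hausdorff_measure_shifted_zero) auto
    then have "hausdorff_dim ?F \<le> ereal (\<delta> / t + e)"
      unfolding hausdorff_dim_def using \<open>0 < \<delta> / t + e\<close> by (intro Inf_lower imageI) simp
    then show "hausdorff_dim ?F \<le> ereal (\<delta> / t) + ereal e"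
      by simp
  qed
  show "ereal (\<delta> / t) \<le> hausdorff_dim ?F"
    unfolding hausdorff_dim_def
  proof (rule Inf_greatest)
    fix y
    assume "y \<in> ereal ` {s. 0 \<le> s \<and> hausdorff_measure s ?F = 0}"
    then obtain s where s: "y = ereal s" "0 \<le> s" "hausdorff_measure s ?F = 0"
      by blast
    have nonzero: "hausdorff_measure s ?F \<noteq> 0" if "0 < s" "s < \<delta> / t" for s
      using that assms \<open>0 < t\<close> by (intro hausdorff_measure_shifted_nonzero) (auto simp: field_simps)
    \<comment> \<open>Nonzero measure at a positive exponent shows this; the counting measure then
      rules out \<open>s = 0\<close>.\<close>
    have "?F \<noteq> {}"
      using nonzero[of "\<delta> / t / 2"] \<open>0 < \<delta> / t\<close> by fastforce
    then have "s \<noteq> 0"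
      using s hausdorff_measure_0_nonempty by blast
    then have "\<delta> / t \<le> s"
      using nonzero[of s] s by fastforce
    then show "ereal (\<delta> / t) \<le> y"
      by (simp add: s)
  qed
qed

theorem proposition3p2:
  fixes F :: "real set"
  defines "F \<equiv> {0..1}"
  shows "dirichlet_spectrum 1 F = {1..2} \<and>
    (\<forall>\<delta>\<in>dirichlet_spectrum 1 F. \<exists>P. abstract_rationals F P \<and> dirichlet_exponent 1 F P = \<delta> \<and>
       (\<forall>t::real. dirichlet_exponent 1 F P \<le> ereal t \<longrightarrow>
          hausdorff_dim (well_approximable F P t) = dirichlet_exponent 1 F P / ereal t))"
proof -
  \<comment> \<open>Gives both the second claim and the inclusion of \<open>{1..2}\<close> in the
    spectrum.\<close>
  have realised: "\<exists>P. abstract_rationals F P \<and> dirichlet_exponent 1 F P = \<delta> \<and>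
       (\<forall>t::real. dirichlet_exponent 1 F P \<le> ereal t \<longrightarrow>
          hausdorff_dim (well_approximable F P t) = dirichlet_exponent 1 F P / ereal t)"
    if "\<delta> \<in> {1..2}" for \<delta>
  proof -
    from that obtain d where d: "\<delta> = ereal d" "1 \<le> d" "d \<le> 2"
      by (cases \<delta>) auto
    then show ?thesis
      unfolding F_def
      by (intro exI[of _ "shifted_rationals d"])
        (auto simp: abstract_rationals_shifted dirichlet_exponent_shifted hausdorff_dim_shifted)
  qed
  then have "dirichlet_spectrum 1 F = {1..2}"
    using dirichlet_exponent_bounds unfolding dirichlet_spectrum_def F_def by fastforce
  with realised show ?thesis
    by blast
qed

end
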